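(* Let $m\ge 1$ and let $g$ be a real-valued function which is nonnegative and nondecreasing on the set of eigenvalues $\{\lambda_i\}_{i=1}^m$ of $A$. Then the eigenvalues $\{\lambda_i\}_{i=1}^{m+1}$ of $A$ satisfy $$\sum_{i=1}^{m} (\lambda_{m+1} - \lambda_i)^2\, g(\lambda_i)\, \rho_i \;\leq\; \sum_{i=1}^{m} (\lambda_{m+1} - \lambda_i)\, g(\lambda_i)\, \Lambda_i .$$
   Context: $\mathcal{H}$ is a complex Hilbert space with inner product $\langle\cdot,\cdot\rangle$ (linear in the first argument, conjugate linear in the second) and norm $\|u\|=\sqrt{\langle u,u\rangle}$. $A:\mathcal{D}\subset\mathcal{H}\to\mathcal{H}$ is a self-adjoint operator defined on a dense domain $\mathcal{D}$, semibounded below, with discrete spectrum $\lambda_1\le\lambda_2\le\lambda_3\le\cdots$ (eigenvalues listed with multiplicity). $\{u_i\}_{i=1}^\infty$ are normalized eigenvectors, $Au_i=\lambda_iu_i$, forming an orthonormal basis of $\mathcal{H}$. $B_1,\dots,B_N$ are symmetric operators, defined on $\mathcal{D}$ and on $A(\mathcal{D})$ with values in $\mathcal{H}$, which leave $\mathcal{D}$ invariant ($B_k(\mathcal{D})\subset\mathcal{D}$). The commutator is $[A,B]=AB-BA$. Define $$\rho_i=\sum_{k=1}^N\langle [A,B_k]u_i,B_ku_i\rangle,\qquad \Lambda_i=\sum_{k=1}^N\|[A,B_k]u_i\|^2 .$$ *)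

theory Defs
  imports "HOL-Analysis.Analysis"
begin

section \<open>Complex Hilbert spaces\<close>

class complex_vector = real_vector +
  fixes scaleC :: "complex \<Rightarrow> 'a \<Rightarrow> 'a"  (infixr "*\<^sub>C" 75)
  assumes scaleC_add_right: "a *\<^sub>C (x + y) = a *\<^sub>C x + a *\<^sub>C y"
    and scaleC_add_left: "(a + b) *\<^sub>C x = a *\<^sub>C x + b *\<^sub>C x"
    and scaleC_scaleC: "a *\<^sub>C (b *\<^sub>C x) = (a * b) *\<^sub>C x"
    and scaleC_one: "1 *\<^sub>C x = x"
    and scaleR_scaleC: "r *\<^sub>R x = complex_of_real r *\<^sub>C x"

global_interpretation complex_vector: vector_space "scaleC :: complex \<Rightarrow> 'a \<Rightarrow> 'a::complex_vector"
  by unfold_locales (simp_all add: scaleC_add_right scaleC_add_left scaleC_scaleC scaleC_one)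

text \<open>The inner product is linear in the first argument and conjugate linear in the second; the
  norm (and with it the metric and the topology) is the one induced by the inner product.\<close>

class complex_inner = complex_vector + real_normed_vector +
  fixes cinner :: "'a \<Rightarrow> 'a \<Rightarrow> complex"
  assumes cinner_commute: "cinner x y = cnj (cinner y x)"
    and cinner_add_left: "cinner (x + y) z = cinner x z + cinner y z"
    and cinner_scaleC_left: "cinner (a *\<^sub>C x) y = a * cinner x y"
    and cinner_ge_zero: "0 \<le> Re (cinner x x)"
    and cinner_eq_zero_iff: "cinner x x = 0 \<longleftrightarrow> x = 0"
    and norm_eq_sqrt_cinner: "norm x = sqrt (Re (cinner x x))"

class chilbert_space = complex_inner + complete_space

instantiation complex :: chilbert_space
begin

definition scaleC_complex :: "complex \<Rightarrow> complex \<Rightarrow> complex"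
  where "scaleC_complex a x = a * x"

definition cinner_complex :: "complex \<Rightarrow> complex \<Rightarrow> complex"
  where "cinner_complex x y = x * cnj y"

instance
  by standard
    (auto simp: scaleC_complex_def cinner_complex_def algebra_simps scaleR_conv_of_real cmod_def
      power2_eq_square)

end

section \<open>Unbounded operators\<close>

text \<open>An operator with domain \<open>D\<close> is given by a total function together with \<open>D\<close>; its values
  outside \<open>D\<close> are irrelevant.\<close>

definition linear_operator :: "'a::complex_vector set \<Rightarrow> ('a \<Rightarrow> 'a) \<Rightarrow> bool" where
  "linear_operator D A \<longleftrightarrow> complex_vector.subspace D \<and>
     (\<forall>x\<in>D. \<forall>y\<in>D. A (x + y) = A x + A y) \<and>
     (\<forall>c. \<forall>x\<in>D. A (c *\<^sub>C x) = c *\<^sub>C A x)"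

definition symmetric_operator :: "'a::complex_inner set \<Rightarrow> ('a \<Rightarrow> 'a) \<Rightarrow> bool" where
  "symmetric_operator D A \<longleftrightarrow> linear_operator D A \<and>
     (\<forall>x\<in>D. \<forall>y\<in>D. cinner (A x) y = cinner x (A y))"

text \<open>The graph of the adjoint of \<open>A\<close>; for dense \<open>D\<close> it is single-valued.\<close>

definition adjoint_graph :: "'a::complex_inner set \<Rightarrow> ('a \<Rightarrow> 'a) \<Rightarrow> ('a \<times> 'a) set" where
  "adjoint_graph D A = {(v, w). \<forall>x\<in>D. cinner (A x) v = cinner x w}"

definition self_adjoint_operator :: "'a::complex_inner set \<Rightarrow> ('a \<Rightarrow> 'a) \<Rightarrow> bool" where
  "self_adjoint_operator D A \<longleftrightarrow> linear_operator D A \<and> closure D = UNIV \<and>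
     adjoint_graph D A = {(v, w). v \<in> D \<and> w = A v}"

definition semibounded_below :: "'a::complex_inner set \<Rightarrow> ('a \<Rightarrow> 'a) \<Rightarrow> bool" where
  "semibounded_below D A \<longleftrightarrow> (\<exists>c::real. \<forall>x\<in>D. c * (norm x)\<^sup>2 \<le> Re (cinner (A x) x))"

definition resolvent_set :: "'a::complex_inner set \<Rightarrow> ('a \<Rightarrow> 'a) \<Rightarrow> complex set" where
  "resolvent_set D A = {z. bij_betw (\<lambda>x. A x - z *\<^sub>C x) D UNIV \<and>
     (\<exists>c::real. \<forall>x\<in>D. norm x \<le> c * norm (A x - z *\<^sub>C x))}"

definition operator_spectrum :: "'a::complex_inner set \<Rightarrow> ('a \<Rightarrow> 'a) \<Rightarrow> complex set" where
  "operator_spectrum D A = - resolvent_set D A"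

definition eigenspace :: "'a::complex_vector set \<Rightarrow> ('a \<Rightarrow> 'a) \<Rightarrow> complex \<Rightarrow> 'a set" where
  "eigenspace D A z = {x \<in> D. A x = z *\<^sub>C x}"

definition eigenvalues :: "'a::complex_vector set \<Rightarrow> ('a \<Rightarrow> 'a) \<Rightarrow> complex set" where
  "eigenvalues D A = {z. \<exists>x \<in> eigenspace D A z. x \<noteq> 0}"

text \<open>The spectrum consists of isolated eigenvalues of finite multiplicity.\<close>

definition discrete_spectrum :: "'a::complex_inner set \<Rightarrow> ('a \<Rightarrow> 'a) \<Rightarrow> bool" where
  "discrete_spectrum D A \<longleftrightarrow> (\<forall>z \<in> operator_spectrum D A.
     z isolated_in operator_spectrum D A \<and> z \<in> eigenvalues D A \<and>
     (\<exists>F. finite F \<and> eigenspace D A z \<subseteq> complex_vector.span F))"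

text \<open>\<open>lam 1 \<le> lam 2 \<le> \<dots>\<close> is the list of all eigenvalues, each repeated according to its
  multiplicity.  Sequences are indexed from \<open>1\<close>; \<open>lam 0\<close> is irrelevant.\<close>

definition eigenvalue_list :: "'a::complex_inner set \<Rightarrow> ('a \<Rightarrow> 'a) \<Rightarrow> (nat \<Rightarrow> real) \<Rightarrow> bool" where
  "eigenvalue_list D A lam \<longleftrightarrow> mono_on {1..} lam \<and>
     eigenvalues D A = (\<lambda>i. complex_of_real (lam i)) ` {1..} \<and>
     (\<forall>i\<ge>1. card {j. 1 \<le> j \<and> lam j = lam i} =
        complex_vector.dim (eigenspace D A (complex_of_real (lam i))))"

definition orthonormal_basis :: "(nat \<Rightarrow> 'a::complex_inner) \<Rightarrow> bool" where
  "orthonormal_basis u \<longleftrightarrow>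
     (\<forall>i\<ge>1. \<forall>j\<ge>1. cinner (u i) (u j) = (if i = j then 1 else 0)) \<and>
     closure (complex_vector.span (u ` {1..})) = UNIV"

definition commutator :: "('a::ab_group_add \<Rightarrow> 'a) \<Rightarrow> ('a \<Rightarrow> 'a) \<Rightarrow> 'a \<Rightarrow> 'a" where
  "commutator A B = (\<lambda>x. A (B x) - B (A x))"

definition rho :: "('a::complex_inner \<Rightarrow> 'a) \<Rightarrow> nat \<Rightarrow> (nat \<Rightarrow> 'a \<Rightarrow> 'a) \<Rightarrow> (nat \<Rightarrow> 'a) \<Rightarrow> nat \<Rightarrow> complex"
  where "rho A N B u i = (\<Sum>k=1..N. cinner (commutator A (B k) (u i)) (B k (u i)))"

definition Lambda :: "('a::complex_inner \<Rightarrow> 'a) \<Rightarrow> nat \<Rightarrow> (nat \<Rightarrow> 'a \<Rightarrow> 'a) \<Rightarrow> (nat \<Rightarrow> 'a) \<Rightarrow> nat \<Rightarrow> real"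
  where "Lambda A N B u i = (\<Sum>k=1..N. (norm (commutator A (B k) (u i)))\<^sup>2)"

lemma self_adjoint_imp_symmetric:
  assumes "self_adjoint_operator D A"
  shows "symmetric_operator D A"
proof -
  have "(y, A y) \<in> adjoint_graph D A" if "y \<in> D" for y
    using assms that by (simp add: self_adjoint_operator_def)
  then show ?thesis
    using assms by (auto simp: self_adjoint_operator_def symmetric_operator_def adjoint_graph_def)
qed

lemma cinner_diff_left: "cinner (x - y) z = cinner x z - cinner y z"
  for x y z :: "'a::complex_inner"
  using cinner_add_left[of "x - y" y z] by (simp add: algebra_simps)

text \<open>Although \<open>rho\<close> is defined as a complex number, it is real, so that passing to \<open>Re\<close> loses
  nothing.\<close>

lemma rho_real:
  fixes A :: "'a::complex_inner \<Rightarrow> 'a" and lam :: "nat \<Rightarrow> real"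
  assumes A: "self_adjoint_operator D A"
    and u: "u i \<in> D" "A (u i) = complex_of_real (lam i) *\<^sub>C u i"
    and B: "\<And>k. k \<in> {1..N} \<Longrightarrow> symmetric_operator (E k) (B k)"
      "\<And>k. k \<in> {1..N} \<Longrightarrow> D \<subseteq> E k" "\<And>k. k \<in> {1..N} \<Longrightarrow> B k ` D \<subseteq> D"
  shows "rho A N B u i \<in> \<real>"
proof -
  have "cinner (commutator A (B k) (u i)) (B k (u i)) \<in> \<real>" if k: "k \<in> {1..N}" for k
  proof -
    let ?v = "B k (u i)"
    have v: "?v \<in> D" using B(3)[OF k] u(1) by blast
    have "cinner (A ?v) ?v = cinner ?v (A ?v)"
      using self_adjoint_imp_symmetric[OF A] v by (simp add: symmetric_operator_def)
    then have 1: "cinner (A ?v) ?v \<in> \<real>"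
      using cinner_commute[of "A ?v" ?v] by (simp add: Reals_cnj_iff)
    have "B k (A (u i)) = complex_of_real (lam i) *\<^sub>C ?v"
      using B(1,2)[OF k] u by (auto simp: symmetric_operator_def linear_operator_def)
    moreover have "cinner ?v ?v \<in> \<real>"
      using cinner_commute[of ?v ?v] by (simp add: Reals_cnj_iff)
    ultimately have "cinner (B k (A (u i))) ?v \<in> \<real>"
      by (simp add: cinner_scaleC_left)
    with 1 show ?thesis
      by (simp add: commutator_def cinner_diff_left)
  qed
  then show ?thesis unfolding rho_def by (intro sum_in_Reals)
qed

end

theory Submission
  imports Defs
begin

text \<open>Write \<open>\<mu> = \<lambda>\<^sub>m\<^sub>+\<^sub>1\<close> and \<open>b i j = \<langle>B u\<^sub>i, u\<^sub>j\<rangle>\<close>.  Since \<open>[A, B] u\<^sub>i = (A - \<lambda>\<^sub>i) B u\<^sub>i\<close>, each \<open>B\<close> contributes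
  \<open>\<langle>(A - \<lambda>\<^sub>i) B u\<^sub>i, (\<mu> - A) B u\<^sub>i\<rangle> = (\<Sum>j. (\<lambda>\<^sub>j - \<lambda>\<^sub>i) (\<mu> - \<lambda>\<^sub>j) |b i j|\<^sup>2)\<close> to
  \<open>(\<mu> - \<lambda>\<^sub>i) \<rho>\<^sub>i - \<Lambda>\<^sub>i\<close>, by Parseval.  The terms with \<open>j > m\<close> are nonpositive.  After multiplication by
  \<open>g(\<lambda>\<^sub>i) (\<mu> - \<lambda>\<^sub>i)\<close> and summation over \<open>i \<le> m\<close>, symmetrizing the remaining finite double sum in
  \<open>i, j\<close> gives terms with the sign of \<open>(g(\<lambda>\<^sub>i) - g(\<lambda>\<^sub>j)) (\<lambda>\<^sub>j - \<lambda>\<^sub>i) \<le> 0\<close>.\<close>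

section \<open>Sesquilinear algebra and Cauchy--Schwarz\<close>

lemma cinner_zero_left [simp]: "cinner 0 y = 0"
  using cinner_diff_left[of y y y] by simp

lemma cinner_sum_left: "cinner (\<Sum>i\<in>I. f i) y = (\<Sum>i\<in>I. cinner (f i) y)"
  by (induction I rule: infinite_finite_induct) (simp_all add: cinner_add_left)

lemma cinner_add_right: "cinner x (y + z) = cinner x y + cinner x z"
  by (metis cinner_commute cinner_add_left complex_cnj_add)

lemma cinner_diff_right: "cinner x (y - z) = cinner x y - cinner x z"
  by (metis cinner_commute cinner_diff_left complex_cnj_diff)

lemma cinner_scaleC_right: "cinner x (a *\<^sub>C y) = cnj a * cinner x y"
  by (metis cinner_commute cinner_scaleC_left complex_cnj_mult)

lemma norm_power2_eq_cinner: "(norm x)\<^sup>2 = Re (cinner x x)"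
  using cinner_ge_zero[of x] by (simp add: norm_eq_sqrt_cinner)

text \<open>The triangle inequality is part of the class \<open>real_normed_vector\<close>, so the real form of
  Cauchy--Schwarz is obtained by squaring it.\<close>

lemma Re_cinner_le_norm: "Re (cinner x y) \<le> norm x * norm y"
proof -
  have "(norm (x + y))\<^sup>2 \<le> (norm x + norm y)\<^sup>2"
    by (intro power_mono norm_triangle_ineq) simp
  moreover have "(norm (x + y))\<^sup>2 = (norm x)\<^sup>2 + (norm y)\<^sup>2 + 2 * Re (cinner x y)"
    using cinner_commute[of y x]
    by (simp add: norm_power2_eq_cinner cinner_add_left cinner_add_right)
  ultimately show ?thesis
    by (simp add: power2_sum)
qed

lemma abs_Re_cinner_le_norm: "\<bar>Re (cinner x y)\<bar> \<le> norm x * norm y"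
  using Re_cinner_le_norm[of x y] Re_cinner_le_norm[of "- x" y] cinner_diff_left[of 0 x y]
  by simp

section \<open>Orthonormal expansions and Parseval's identity\<close>

text \<open>For orthonormal \<open>u\<close> this is the orthogonal projection of \<open>x\<close>
  onto the span of \<open>u 1\<close>, ..., \<open>u n\<close>.\<close>

definition fourier_sum :: "(nat \<Rightarrow> 'a::complex_inner) \<Rightarrow> nat \<Rightarrow> 'a \<Rightarrow> 'a" where
  "fourier_sum u n x = (\<Sum>j=1..n. cinner x (u j) *\<^sub>C u j)"

lemma fourier_sum_add: "fourier_sum u n (x + y) = fourier_sum u n x + fourier_sum u n y"
  by (simp add: fourier_sum_def cinner_add_left scaleC_add_left sum.distrib)

lemma fourier_sum_diff: "fourier_sum u n (x - y) = fourier_sum u n x - fourier_sum u n y"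
  using fourier_sum_add[of u n "x - y" y] by (simp add: algebra_simps)

lemma fourier_sum_scaleC: "fourier_sum u n (a *\<^sub>C x) = a *\<^sub>C fourier_sum u n x"
  by (simp add: fourier_sum_def cinner_scaleC_left complex_vector.scale_sum_right scaleC_scaleC)

lemma cinner_fourier_sum:
  "cinner (fourier_sum u n x) y = (\<Sum>j=1..n. cinner x (u j) * cnj (cinner y (u j)))"
proof -
  have "cinner (u j) y = cnj (cinner y (u j))" for j
    by (rule cinner_commute)
  then show ?thesis
    by (simp add: fourier_sum_def cinner_sum_left cinner_scaleC_left)
qed

context
  fixes u :: "nat \<Rightarrow> 'a::complex_inner"
  assumes basis: "orthonormal_basis u"
begin

lemma cinner_basis: "i \<ge> 1 \<Longrightarrow> j \<ge> 1 \<Longrightarrow> cinner (u i) (u j) = (if i = j then 1 else 0)"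
  using basis by (simp add: orthonormal_basis_def)

lemma fourier_sum_basis:
  assumes "1 \<le> j" "j \<le> n"
  shows "fourier_sum u n (u j) = u j"
proof -
  have "fourier_sum u n (u j) = (\<Sum>i=1..n. if j = i then u j else 0)"
    unfolding fourier_sum_def using assms
    by (intro sum.cong) (auto simp: cinner_basis scaleC_one)
  then show ?thesis using assms by simp
qed

lemma cinner_fourier_sum_basis:
  assumes "1 \<le> j" "j \<le> n"
  shows "cinner (fourier_sum u n x) (u j) = cinner x (u j)"
proof -
  have "cinner (fourier_sum u n x) (u j) = (\<Sum>i=1..n. if j = i then cinner x (u j) else 0)"
    unfolding cinner_fourier_sum using assms
    by (intro sum.cong) (auto simp: cinner_basis)
  then show ?thesis using assms by simp
qed

text \<open>Bessel's inequality: \<open>?S\<close> and \<open>x\<close> have the same first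
  \<open>n\<close> coefficients, so \<open>cinner ?S ?S = cinner ?S x\<close>. Cauchy--Schwarz then
  allows one factor \<open>norm ?S\<close> to be cancelled.\<close>

lemma norm_fourier_sum_le: "norm (fourier_sum u n x) \<le> norm x"
proof -
  let ?S = "fourier_sum u n x"
  have "cinner ?S ?S = cinner ?S x"
    unfolding cinner_fourier_sum[of u n x ?S] cinner_fourier_sum[of u n x x]
    by (intro sum.cong) (simp_all add: cinner_fourier_sum_basis)
  then have "norm ?S * norm ?S \<le> norm ?S * norm x"
    using Re_cinner_le_norm[of ?S x] norm_power2_eq_cinner[of ?S] by (simp add: power2_eq_square)
  then show ?thesis
    by (cases "norm ?S = 0") auto
qed

text \<open>A finite combination involves finitely many indices; once \<open>n\<close> reaches the
  largest, the projection fixes it.\<close>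

lemma eventually_fourier_sum_span:
  assumes "z \<in> complex_vector.span (u ` {1..})"
  shows "\<forall>\<^sub>F n in sequentially. fourier_sum u n z = z"
  using assms
proof (induction rule: complex_vector.span_induct_alt)
  case base
  show ?case by (simp add: fourier_sum_def)
next
  case (step c x y)
  then obtain j where j: "1 \<le> j" "x = u j" by auto
  from step(2) eventually_ge_at_top[of j] show ?case
    by eventually_elim (use j in \<open>simp add: fourier_sum_add fourier_sum_scaleC fourier_sum_basis\<close>)
qed

lemma fourier_sum_tendsto: "(\<lambda>n. fourier_sum u n x) \<longlonglongrightarrow> x"
proof (rule tendstoI)
  fix e :: real assume "e > 0"
  have "x \<in> closure (complex_vector.span (u ` {1..}))"
    using basis by (simp add: orthonormal_basis_def)
  then obtain z where z: "z \<in> complex_vector.span (u ` {1..})" "dist z x < e / 2"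
    using \<open>e > 0\<close> unfolding closure_approachable by (meson half_gt_zero)
  from eventually_fourier_sum_span[OF z(1)]
  show "\<forall>\<^sub>F n in sequentially. dist (fourier_sum u n x) x < e"
  proof eventually_elim
    case (elim n)
    \<comment> \<open>As \<open>z\<close> is fixed by the projection, the error splits into two
      parts, each of norm below \<open>e / 2\<close> because projecting does not increase
      norms.\<close>
    then have eq: "fourier_sum u n x - x = fourier_sum u n (x - z) + (z - x)"
      by (simp add: fourier_sum_diff)
    have "norm (fourier_sum u n x - x) \<le> norm (x - z) + norm (z - x)"
      unfolding eq by (intro norm_triangle_mono norm_fourier_sum_le order_refl)
    then show ?case
      using z(2) by (simp add: dist_norm norm_minus_commute)
  qed
qed

text \<open>Cauchy--Schwarz transfers the convergence of the projections to the inner product. The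
  limit form lets tails be estimated on finite sums.\<close>

lemma parseval_Re:
  "(\<lambda>n. \<Sum>j=1..n. Re (cinner x (u j) * cnj (cinner y (u j)))) \<longlonglongrightarrow> Re (cinner x y)"
proof -
  have "(\<lambda>n. norm (fourier_sum u n x - x) * norm y) \<longlonglongrightarrow> 0"
    using fourier_sum_tendsto[of x]
    by (intro tendsto_mult_left_zero tendsto_norm_zero) (simp add: LIM_zero)
  then have "(\<lambda>n. Re (cinner (fourier_sum u n x - x) y)) \<longlonglongrightarrow> 0"
    by (rule Lim_null_comparison[rotated]) (simp add: abs_Re_cinner_le_norm)
  then have "(\<lambda>n. Re (cinner (fourier_sum u n x) y)) \<longlonglongrightarrow> Re (cinner x y)"
    by (simp add: cinner_diff_left LIM_zero_iff)
  then show ?thesis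
    by (simp add: cinner_fourier_sum)
qed

end

section \<open>Symmetrization and the commutator inequalities\<close>

text \<open>Exchanging the indices leaves the double sum unchanged, so twice its value is the sum of
  the symmetrized terms.\<close>

lemma sum_swap_nonpos:
  fixes F :: "'a \<Rightarrow> 'a \<Rightarrow> real"
  assumes "\<And>i j. i \<in> I \<Longrightarrow> j \<in> I \<Longrightarrow> F i j + F j i \<le> 0"
  shows "(\<Sum>i\<in>I. \<Sum>j\<in>I. F i j) \<le> 0"
proof -
  have "2 * (\<Sum>i\<in>I. \<Sum>j\<in>I. F i j) = (\<Sum>i\<in>I. \<Sum>j\<in>I. F i j) + (\<Sum>i\<in>I. \<Sum>j\<in>I. F j i)"
    by (subst (3) sum.swap) simp
  also have "\<dots> = (\<Sum>i\<in>I. \<Sum>j\<in>I. F i j + F j i)"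
    by (simp add: sum.distrib)
  also have "\<dots> \<le> 0"
    by (intro sum_nonpos assms)
  finally show ?thesis by simp
qed

lemma commutator_eigenvector_bound:
  fixes u :: "nat \<Rightarrow> 'h::complex_inner" and lam :: "nat \<Rightarrow> real"
  assumes A: "symmetric_operator D A"
    and lam: "mono_on {1..} lam"
    and u: "orthonormal_basis u"
    and eig: "\<And>i. i \<ge> 1 \<Longrightarrow> u i \<in> D \<and> A (u i) = complex_of_real (lam i) *\<^sub>C u i"
    and B: "symmetric_operator E B" "D \<subseteq> E" "B ` D \<subseteq> D"
    and i: "i \<in> {1..m}"
  shows "(lam (m + 1) - lam i) * Re (cinner (commutator A B (u i)) (B (u i)))
           - (norm (commutator A B (u i)))\<^sup>2
         \<le> (\<Sum>j=1..m. (lam j - lam i) * (lam (m + 1) - lam j) * (cmod (cinner (B (u i)) (u j)))\<^sup>2)"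
    (is "?L \<le> sum ?f _")
proof -
  let ?mu = "lam (m + 1)" and ?v = "B (u i)" and ?w = "commutator A B (u i)"
  \<comment> \<open>This is \<open>(?mu - A) ?v\<close>, because \<open>?w\<close> is
    \<open>(A - lam i) ?v\<close>. Written through \<open>?w\<close>, it turns \<open>?L\<close>
    into a single inner product.\<close>
  let ?y = "complex_of_real (?mu - lam i) *\<^sub>C ?v - ?w"
  have v: "?v \<in> D" using B(3) eig i by auto
  have w: "?w = A ?v - complex_of_real (lam i) *\<^sub>C ?v"
    using B(1,2) eig[of i] i
    by (auto simp: commutator_def symmetric_operator_def linear_operator_def)
  have L: "?L = Re (cinner ?w ?y)"
    by (simp add: cinner_diff_right cinner_scaleC_right norm_power2_eq_cinner)
  \<comment> \<open>Symmetry moves \<open>A\<close> onto \<open>u j\<close>, which requires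
    \<open>?v\<close> in \<open>D\<close>; the eigenvalue is real, so conjugation leaves it
    alone.\<close>
  have Aj: "cinner (A ?v) (u j) = complex_of_real (lam j) * cinner ?v (u j)" if "j \<ge> 1" for j
    using A v eig[OF that] by (simp add: symmetric_operator_def cinner_scaleC_right)
  have term_eq: "Re (cinner ?w (u j) * cnj (cinner ?y (u j))) = ?f j" if "j \<ge> 1" for j
  proof -
    have wj: "cinner ?w (u j) = complex_of_real (lam j - lam i) * cinner ?v (u j)"
      by (simp only: w cinner_diff_left cinner_scaleC_left Aj[OF that] of_real_diff left_diff_distrib)
    have yj: "cinner ?y (u j) = complex_of_real (?mu - lam j) * cinner ?v (u j)"
      by (simp only: cinner_diff_left cinner_scaleC_left wj of_real_diff) (simp add: algebra_simps)
    have "cinner ?w (u j) * cnj (cinner ?y (u j)) =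
        complex_of_real ((lam j - lam i) * (?mu - lam j)) * (cinner ?v (u j) * cnj (cinner ?v (u j)))"
      unfolding wj yj by (simp add: ac_simps)
    also have "\<dots> = complex_of_real (?f j)"
      by (simp only: complex_norm_square[symmetric] of_real_mult)
    finally show ?thesis by simp
  qed
  have "(\<Sum>j=1..n. Re (cinner ?w (u j) * cnj (cinner ?y (u j)))) = sum ?f {1..n}" for n
    by (intro sum.cong refl term_eq) simp
  then have "(\<lambda>n. sum ?f {1..n}) \<longlonglongrightarrow> ?L"
    using parseval_Re[OF u, of ?w ?y] by (simp only: L)
  moreover have "sum ?f {1..n} \<le> sum ?f {1..m}" if "n \<ge> m" for n
  proof -
    \<comment> \<open>Beyond \<open>m\<close> the ordering gives
      \<open>lam i \<le> ?mu \<le> lam j\<close>, so the first factor is nonnegative and the second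
      nonpositive.\<close>
    have "?f j \<le> 0" if j: "j \<in> {1..n} - {1..m}" for j
    proof -
      have "lam i \<le> lam j" "?mu \<le> lam j"
        using i j by (auto intro!: mono_onD[OF lam])
      then show ?thesis
        by (intro mult_nonpos_nonneg mult_nonneg_nonpos) auto
    qed
    then have "sum ?f ({1..n} - {1..m}) \<le> 0"
      by (rule sum_nonpos)
    then show ?thesis
      using sum.subset_diff[of "{1..m}" "{1..n}" ?f] that by auto
  qed
  ultimately show ?thesis
    by (intro LIMSEQ_le_const2) auto
qed

text \<open>The share of a single operator: \<open>rho\<close> and \<open>Lambda\<close> are sums
  over \<open>k\<close>, so adding these bounds yields the theorem.\<close>

lemma weighted_commutator_bound:
  fixes u :: "nat \<Rightarrow> 'h::complex_inner" and lam :: "nat \<Rightarrow> real" and g :: "real \<Rightarrow> real"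
  assumes A: "symmetric_operator D A"
    and lam: "mono_on {1..} lam"
    and u: "orthonormal_basis u"
    and eig: "\<And>i. i \<ge> 1 \<Longrightarrow> u i \<in> D \<and> A (u i) = complex_of_real (lam i) *\<^sub>C u i"
    and B: "symmetric_operator E B" "D \<subseteq> E" "B ` D \<subseteq> D"
    and g: "\<And>i. i \<in> {1..m} \<Longrightarrow> g (lam i) \<ge> 0" "mono_on (lam ` {1..m}) g"
  shows "(\<Sum>i=1..m. (lam (m + 1) - lam i)\<^sup>2 * g (lam i) *
             Re (cinner (commutator A B (u i)) (B (u i))))
       \<le> (\<Sum>i=1..m. (lam (m + 1) - lam i) * g (lam i) * (norm (commutator A B (u i)))\<^sup>2)"
proof -
  let ?mu = "lam (m + 1)"
  define r where "r i = Re (cinner (commutator A B (u i)) (B (u i)))" for i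
  define s where "s i = (norm (commutator A B (u i)))\<^sup>2" for i
  define b where "b i j = (cmod (cinner (B (u i)) (u j)))\<^sup>2" for i j
  define F where "F i j = g (lam i) * (?mu - lam i) * ((lam j - lam i) * (?mu - lam j) * b i j)"
    for i j
  have le_mu: "lam i \<le> ?mu" if "i \<in> {1..m}" for i
    using that by (auto intro!: mono_onD[OF lam])
  \<comment> \<open>Symmetry of \<open>B\<close> makes the two matrix entries complex conjugates,
    hence equal in modulus.\<close>
  have b_sym: "b i j = b j i" if "i \<in> {1..m}" "j \<in> {1..m}" for i j
  proof -
    have "cinner (B (u i)) (u j) = cinner (u i) (B (u j))"
      using B(1,2) eig that by (auto simp: symmetric_operator_def)
    also have "\<dots> = cnj (cinner (B (u j)) (u i))"
      by (rule cinner_commute)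
    finally show ?thesis by (simp add: b_def)
  qed
  have F_sym: "F i j + F j i \<le> 0" if ij: "i \<in> {1..m}" "j \<in> {1..m}" for i j
  proof -
    have "(g (lam i) - g (lam j)) * (lam j - lam i) \<le> 0"
    proof (cases "lam i \<le> lam j")
      case True
      then have "g (lam i) \<le> g (lam j)"
        using ij by (intro mono_onD[OF g(2)]) auto
      with True show ?thesis by (intro mult_nonpos_nonneg) auto
    next
      case False
      then have "g (lam j) \<le> g (lam i)"
        using ij by (intro mono_onD[OF g(2)]) auto
      with False show ?thesis by (intro mult_nonneg_nonpos) auto
    qed
    moreover have "0 \<le> (?mu - lam i) * (?mu - lam j) * b i j"
      using le_mu ij by (simp add: b_def)
    ultimately have "(g (lam i) - g (lam j)) * (lam j - lam i) *
        ((?mu - lam i) * (?mu - lam j) * b i j) \<le> 0"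
      by (rule mult_nonpos_nonneg)
    \<comment> \<open>The factor \<open>(?mu - lam i) * (?mu - lam j) * b i j\<close> is symmetric,
      while \<open>lam j - lam i\<close> changes sign under the exchange; only the difference of the
      \<open>g\<close> values survives.\<close>
    moreover have "F i j + F j i = (g (lam i) - g (lam j)) * (lam j - lam i) *
        ((?mu - lam i) * (?mu - lam j) * b i j)"
      using b_sym[OF ij] by (simp add: F_def algebra_simps)
    ultimately show ?thesis by simp
  qed
  have "(\<Sum>i=1..m. (?mu - lam i)\<^sup>2 * g (lam i) * r i) - (\<Sum>i=1..m. (?mu - lam i) * g (lam i) * s i)
      = (\<Sum>i=1..m. g (lam i) * (?mu - lam i) * ((?mu - lam i) * r i - s i))"
    unfolding sum_subtractf[symmetric]
    by (intro sum.cong refl) (simp add: power2_eq_square algebra_simps)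
  also have "\<dots> \<le> (\<Sum>i=1..m. \<Sum>j=1..m. F i j)"
  proof (intro sum_mono)
    fix i assume i: "i \<in> {1..m}"
    have "(?mu - lam i) * r i - s i \<le> (\<Sum>j=1..m. (lam j - lam i) * (?mu - lam j) * b i j)"
      unfolding r_def s_def b_def
      by (rule commutator_eigenvector_bound[OF A lam u eig B i])
    \<comment> \<open>Here nonnegativity of \<open>g\<close> and \<open>lam i \<le> ?mu\<close> make
      the weight nonnegative.\<close>
    then have "g (lam i) * (?mu - lam i) * ((?mu - lam i) * r i - s i) \<le>
        g (lam i) * (?mu - lam i) * (\<Sum>j=1..m. (lam j - lam i) * (?mu - lam j) * b i j)"
      using g(1)[OF i] le_mu[OF i] by (intro mult_left_mono) auto
    then show "g (lam i) * (?mu - lam i) * ((?mu - lam i) * r i - s i) \<le> (\<Sum>j=1..m. F i j)"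
      by (simp only: F_def sum_distrib_left)
  qed
  also have "\<dots> \<le> 0"
    by (rule sum_swap_nonpos) (rule F_sym)
  finally show ?thesis by (simp add: r_def s_def)
qed

theorem theorem2:
  fixes D :: "'h::chilbert_space set" and A :: "'h \<Rightarrow> 'h"
    and lam :: "nat \<Rightarrow> real" and u :: "nat \<Rightarrow> 'h"
    and N :: nat and E :: "nat \<Rightarrow> 'h set" and B :: "nat \<Rightarrow> 'h \<Rightarrow> 'h"
    and m :: nat and g :: "real \<Rightarrow> real"
  assumes "self_adjoint_operator D A"
    and "semibounded_below D A"
    and "discrete_spectrum D A"
    and "eigenvalue_list D A lam"
    and "orthonormal_basis u"
    and "\<And>i. i \<ge> 1 \<Longrightarrow> u i \<in> D \<and> A (u i) = complex_of_real (lam i) *\<^sub>C u i"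
    and "\<And>k. k \<in> {1..N} \<Longrightarrow> symmetric_operator (E k) (B k)"
    and "\<And>k. k \<in> {1..N} \<Longrightarrow> D \<subseteq> E k \<and> A ` D \<subseteq> E k"
    and "\<And>k. k \<in> {1..N} \<Longrightarrow> B k ` D \<subseteq> D"
    and "m \<ge> 1"
    and "\<And>i. i \<in> {1..m} \<Longrightarrow> g (lam i) \<ge> 0"
    and "mono_on (lam ` {1..m}) g"
  shows "(\<Sum>i=1..m. (lam (m + 1) - lam i)\<^sup>2 * g (lam i) * Re (rho A N B u i))
       \<le> (\<Sum>i=1..m. (lam (m + 1) - lam i) * g (lam i) * Lambda A N B u i)"
proof -
  let ?mu = "lam (m + 1)"
  have lam: "mono_on {1..} lam"
    using assms(4) by (simp add: eigenvalue_list_def)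
  have "(\<Sum>i=1..m. (?mu - lam i)\<^sup>2 * g (lam i) * Re (rho A N B u i))
      = (\<Sum>k=1..N. \<Sum>i=1..m. (?mu - lam i)\<^sup>2 * g (lam i) *
          Re (cinner (commutator A (B k) (u i)) (B k (u i))))"
    unfolding rho_def Re_sum sum_distrib_left by (rule sum.swap)
  also have "\<dots> \<le> (\<Sum>k=1..N. \<Sum>i=1..m. (?mu - lam i) * g (lam i) *
      (norm (commutator A (B k) (u i)))\<^sup>2)"
  proof (rule sum_mono)
    fix k assume k: "k \<in> {1..N}"
    show "(\<Sum>i=1..m. (?mu - lam i)\<^sup>2 * g (lam i) *
          Re (cinner (commutator A (B k) (u i)) (B k (u i))))
        \<le> (\<Sum>i=1..m. (?mu - lam i) * g (lam i) * (norm (commutator A (B k) (u i)))\<^sup>2)"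
      using weighted_commutator_bound[OF self_adjoint_imp_symmetric[OF assms(1)] lam assms(5,6)
          assms(7)[OF k] _ assms(9)[OF k] assms(11,12)] assms(8)[OF k] by blast
  qed
  also have "\<dots> = (\<Sum>i=1..m. (?mu - lam i) * g (lam i) * Lambda A N B u i)"
    unfolding Lambda_def sum_distrib_left by (rule sum.swap)
  finally show ?thesis .
qed

end
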